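(* Let $\beta\in[0,1]$. If $f\in\mathcal{A}_\beta$ has the form $f(z)=z+\sum_{n=2}^\infty a_n z^n$, then $$|J_{2,3}(f)|\le \frac{2}{4-3\beta}.$$ The bound is sharp.
   Context: $\mathbb{D}=\{z\in\mathbb{C}:|z|<1\}$. $\mathcal{A}$ is the class of holomorphic functions $f$ on $\mathbb{D}$ of the form $f(z)=z+\sum_{n=2}^\infty a_n z^n$. For $\beta\in[0,1]$, $\mathcal{A}_\beta=\{f\in\mathcal{A}:\operatorname{Re}(\beta \frac{f(z)}{z}+(1-\beta)f'(z))>0 \text{ for all } z\in\mathbb{D}\}$, where $f(z)/z$ takes the value $1$ at $z=0$. The generalized Zalcman functional is $J_{m,n}(f)=a_na_m-a_{n+m-1}$, so $J_{2,3}(f)=a_2a_3-a_4$. A bound being sharp means that equality is attained for some $f\in\mathcal{A}_\beta$. *)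

theory Defs
  imports "HOL-Complex_Analysis.Complex_Analysis"
begin

abbreviation unit_disc :: "complex set" where
  "unit_disc \<equiv> ball 0 1"

definition coef :: "(complex \<Rightarrow> complex) \<Rightarrow> nat \<Rightarrow> complex" where
  "coef f n = fps_nth (fps_expansion f 0) n"

text \<open>The power series of a function on the disc is unique and is its Taylor series, so
  ``f is of the form z + a2 z^2 + ...'' is stated with the Taylor coefficients
  of f as its coefficients.\<close>

definition class_A :: "(complex \<Rightarrow> complex) set" where
  "class_A = {f. f holomorphic_on unit_disc \<and>
     (\<forall>z\<in>unit_disc. (\<lambda>n. coef f (n + 2) * z ^ (n + 2)) sums (f z - z))}"

definition quot_z :: "(complex \<Rightarrow> complex) \<Rightarrow> complex \<Rightarrow> complex" where
  "quot_z f z = (if z = 0 then 1 else f z / z)"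

definition class_A_beta :: "real \<Rightarrow> (complex \<Rightarrow> complex) set" where
  "class_A_beta \<beta> = {f \<in> class_A. \<forall>z\<in>unit_disc.
     Re (of_real \<beta> * quot_z f z + of_real (1 - \<beta>) * deriv f z) > 0}"

text \<open>The index is subtracted in the naturals; the functional is only meant for positive indices,
  where no truncation occurs.\<close>

definition zalcman :: "nat \<Rightarrow> nat \<Rightarrow> (complex \<Rightarrow> complex) \<Rightarrow> complex" where
  "zalcman m n f = coef f n * coef f m - coef f (n + m - 1)"

end

theory Submission
  imports Defs
begin

text \<open>
  For \<open>f\<close> in \<open>class_A_beta \<beta>\<close> the function \<open>p z = \<beta> * f z / z + (1 - \<beta>) * f' z\<close> is
  holomorphic with \<open>p 0 = 1\<close> and positive real part, and its coefficients
  \<open>c\<^sub>n = (\<beta> + (1 - \<beta>) * (n + 1)) * a\<^bsub>n+1\<^esub>\<close> are explicit multiples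
  of the coefficients \<open>a\<^sub>n\<close> of \<open>f\<close>. Hence
  \<open>a\<^sub>4 - a\<^sub>2 * a\<^sub>3 = (c\<^sub>3 - \<mu> * c\<^sub>1 * c\<^sub>2) / (4 - 3 * \<beta>)\<close> with
  \<open>\<mu> = (4 - 3 * \<beta>) / ((2 - \<beta>) * (3 - 2 * \<beta>))\<close>. The identity
  \<open>(2 - \<beta>) * (3 - 2 * \<beta>) - (4 - 3 * \<beta>) = 2 * (1 - \<beta>)\<^sup>2\<close> puts \<open>\<mu>\<close> in the unit interval, so
  the bound follows from \<open>|c\<^sub>3 - \<mu> * c\<^sub>1 * c\<^sub>2| \<le> 2\<close> for functions of positive real part
  (\<open>caratheodory_class_bound\<close>).

  To see the latter, regard \<open>Re (p (r * x)) / (2 * \<pi>)\<close> as a probability density on the unit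
  circle \<open>|x| = 1\<close>. By Cauchy's formulas the mean of \<open>(cnj x) ^ k\<close> is \<open>c\<^sub>k * r ^ k / 2\<close> for
  \<open>k > 0\<close> (\<open>Re_circle_moment\<close>). With \<open>y = cnj x\<close>, the mean of the nonnegative quantity
  \<open>|y\<^sup>3 - s * y - \<omega>|\<^sup>2\<close> is therefore an explicit expression in \<open>c\<^sub>1, c\<^sub>2, c\<^sub>3\<close>. Taking
  \<open>s = \<mu> * c\<^sub>2 * r\<^sup>2\<close> and \<open>\<omega>\<close> as the direction of \<open>c\<^sub>3 - \<mu> * c\<^sub>1 * c\<^sub>2\<close>, its nonnegativity reads
  \<open>r\<^sup>3 * |c\<^sub>3 - \<mu> * c\<^sub>1 * c\<^sub>2| \<le> 2 - \<mu> * (1 - \<mu>) * |c\<^sub>2 * r\<^sup>2|\<^sup>2\<close>; then \<open>r\<close> tends to 1.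

  Equality holds for the \<open>f\<close> with \<open>p z = (1 + z\<^sup>3) / (1 - z\<^sup>3)\<close>, since then \<open>c\<^sub>1 = c\<^sub>2 = 0\<close> and
  \<open>c\<^sub>3 = 2\<close>. This \<open>f\<close> is defined by its power series.
\<close>

section \<open>Taylor coefficients\<close>

lemma coef_eqI: "f has_fps_expansion F \<Longrightarrow> coef f n = fps_nth F n"
  by (simp add: coef_def fps_expansion_eqI)

lemma has_fps_expansion_on_disc:
  assumes "f holomorphic_on unit_disc"
  shows "f has_fps_expansion fps_expansion f 0"
  using assms by (intro has_fps_expansion_fps_expansion[of unit_disc]) auto

lemma sums_coef:
  assumes "f holomorphic_on unit_disc" "z \<in> unit_disc"
  shows "(\<lambda>n. coef f n * z ^ n) sums f z"
  using holomorphic_power_series[OF assms] by (simp add: coef_def fps_expansion_def)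

section \<open>Functions with positive real part\<close>

lemma circle_moment_cnj:
  assumes p: "p holomorphic_on unit_disc" and r: "0 < r" "r < 1"
  shows "((\<lambda>t. p (of_real r * cis t) * cnj (cis t) ^ k) has_integral
           2 * pi * coef p k * of_real r ^ k) {0..2*pi}"
proof -
  have sub: "cball 0 r \<subseteq> unit_disc" "ball 0 r \<subseteq> unit_disc"
    using r by auto
  have "((\<lambda>u. p u / (u - 0) ^ Suc k) has_contour_integral
          (2 * pi * \<i>) / fact k * (deriv ^^ k) p 0) (circlepath 0 r)"
    by (rule Cauchy_has_contour_integral_higher_derivative_circlepath)
       (use p sub r in \<open>auto intro: holomorphic_on_imp_continuous_on holomorphic_on_subset\<close>)
  then have "((\<lambda>t. p (of_real r * cis t) / (of_real r * cis t) ^ Suc k * of_real r * \<i> * cis t)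
        has_integral 2 * pi * \<i> * coef p k) {0..2*pi}"
    by (simp add: circlepath_def has_contour_integral_part_circlepath_iff coef_def
          fps_expansion_def mult_ac)
  from has_integral_mult_right[OF this, of "of_real r ^ k / \<i>"]
  have "((\<lambda>t. of_real r ^ k / \<i> *
          (p (of_real r * cis t) / (of_real r * cis t) ^ Suc k * of_real r * \<i> * cis t))
        has_integral 2 * pi * coef p k * of_real r ^ k) {0..2*pi}"
    by (simp add: mult_ac)
  moreover have "of_real r ^ k / \<i> *
        (p (of_real r * cis t) / (of_real r * cis t) ^ Suc k * of_real r * \<i> * cis t)
      = p (of_real r * cis t) * cnj (cis t) ^ k" for t
  proof -
    have "cis t \<noteq> 0" "cnj (cis t) = inverse (cis t)" "complex_of_real r \<noteq> 0"
      using r by (auto simp: cis_cnj)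
    moreover have "cis t ^ k * cnj (cis t) ^ k = 1"
      by (simp add: cis_cnj cis_mult flip: power_mult_distrib)
    ultimately show ?thesis by (simp add: field_simps power_mult_distrib)
  qed
  ultimately show ?thesis by simp
qed

lemma circle_moment_pos:
  assumes p: "p holomorphic_on unit_disc" and r: "0 < r" "r < 1"
  shows "((\<lambda>t. p (of_real r * cis t) * cis t ^ Suc k) has_integral 0) {0..2*pi}"
proof -
  have "((\<lambda>u. p u * u ^ k) has_contour_integral 0) (circlepath 0 r)"
    by (rule Cauchy_theorem_disc_simple[of _ 0 1])
       (use p r in \<open>auto intro!: holomorphic_intros\<close>)
  then have "((\<lambda>t. p (of_real r * cis t) * (of_real r * cis t) ^ k * of_real r * \<i> * cis t)
        has_integral 0) {0..2*pi}"
    by (simp add: circlepath_def has_contour_integral_part_circlepath_iff mult_ac)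
  from has_integral_mult_right[OF this, of "1 / (\<i> * of_real r ^ Suc k)"] r
  show ?thesis
    by (simp add: power_mult_distrib field_simps)
qed

text \<open>On the circle the conjugate of \<open>p\<close> has no positive frequencies, so it is orthogonal to
  \<open>cis t ^ Suc k\<close>, and \<open>Re p\<close>, the mean of \<open>p\<close> and its conjugate, has half the
  moment of \<open>p\<close>.\<close>

lemma Re_circle_moment:
  assumes p: "p holomorphic_on unit_disc" and r: "0 < r" "r < 1"
  shows "((\<lambda>t. of_real (Re (p (of_real r * cis t))) * cnj (cis t) ^ Suc k) has_integral
           pi * coef p (Suc k) * of_real r ^ Suc k) {0..2*pi}"
proof -
  have "((\<lambda>t. cnj (p (of_real r * cis t) * cis t ^ Suc k)) has_integral 0) {0..2*pi}"
    using has_integral_cnj[THEN iffD2, OF circle_moment_pos[OF assms, of k]] by (simp add: o_def)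
  from has_integral_add[OF circle_moment_cnj[OF assms, of "Suc k"] this]
  have "((\<lambda>t. (p (of_real r * cis t) + cnj (p (of_real r * cis t))) * cnj (cis t) ^ Suc k)
     has_integral 2 * pi * coef p (Suc k) * of_real r ^ Suc k) {0..2*pi}"
    by (simp add: ring_distribs)
  from has_integral_mult_right[OF this, of "1/2"] show ?thesis
    by (simp add: complex_add_cnj mult.assoc)
qed

lemma norm_diff_diff_power2:
  fixes a b c :: complex
  shows "(norm (a - b - c))\<^sup>2 = (norm a)\<^sup>2 + (norm b)\<^sup>2 + (norm c)\<^sup>2
           - 2 * Re (a * cnj b) - 2 * Re (cnj c * a) + 2 * Re (cnj c * b)"
  unfolding cmod_power2 by (simp add: algebra_simps power2_eq_square)

text \<open>This bound interpolates between Caratheodory's \<open>|c\<^sub>3| \<le> 2\<close> and Livingston's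
  \<open>|c\<^sub>3 - c\<^sub>1 * c\<^sub>2| \<le> 2\<close>. Integrating the square of the modulus of a trinomial against the
  nonnegative density \<open>Re p\<close> gives both ends and everything between them at once.\<close>

lemma caratheodory_class_bound:
  assumes p: "p holomorphic_on unit_disc" and p0: "p 0 = 1"
    and pos: "\<And>z. z \<in> unit_disc \<Longrightarrow> 0 \<le> Re (p z)"
    and mu: "0 \<le> \<mu>" "\<mu> \<le> 1"
  shows "norm (coef p 3 - of_real \<mu> * coef p 1 * coef p 2) \<le> 2"
proof -
  define w where "w = coef p 3 - of_real \<mu> * coef p 1 * coef p 2"
  have bound: "norm w * r ^ 3 \<le> 2" if r: "0 < r" "r < 1" for r :: real
  proof -
    define h where "h t = Re (p (of_real r * cis t))" for t
    define y where "y t = cnj (cis t)" for t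
    define C where "C k = coef p k * of_real r ^ k" for k
    define \<omega> where "\<omega> = sgn w"
    \<comment> \<open>This \<open>s\<close> makes the cross terms combine into \<open>C 3 - \<mu> * C 1 * C 2\<close>; what remains is
      \<open>\<mu> * (1 - \<mu>) * |C 2|\<^sup>2\<close>, which is nonnegative for \<open>\<mu>\<close> in the unit interval.\<close>
    define s where "s = of_real \<mu> * C 2"
    have moment: "((\<lambda>t. Re (c * (of_real (h t) * y t ^ k))) has_integral Re (c * (pi * C k))) {0..2*pi}"
      if "0 < k" for c k
      using has_integral_Re[OF has_integral_mult_right[OF Re_circle_moment[OF p r, of "k - 1"], of c]] that
      by (simp add: h_def y_def C_def mult_ac)
    have mass: "(h has_integral 2 * pi) {0..2*pi}"
      using has_integral_Re[OF circle_moment_cnj[OF p r, of 0]] p0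
      by (simp add: h_def[abs_def] coef_def fps_expansion_def)
    have expand: "h t * (norm (y t ^ 3 - s * y t - \<omega>))\<^sup>2 =
        h t * (1 + (norm s)\<^sup>2 + (norm \<omega>)\<^sup>2)
        - Re (2 * cnj s * (of_real (h t) * y t ^ 2)) - Re (2 * cnj \<omega> * (of_real (h t) * y t ^ 3))
        + Re (2 * cnj \<omega> * s * (of_real (h t) * y t ^ 1))" for t
    proof -
      have "norm (y t) = 1" and "y t * cnj (y t) = 1"
        by (simp_all add: y_def cis_mult cis_cnj)
      then have y: "norm (y t ^ 3) = 1" "norm (s * y t) = norm s" "y t ^ 3 * cnj (y t) = y t ^ 2"
        by (simp_all add: norm_power norm_mult power3_eq_cube power2_eq_square mult.assoc)
      have "(norm (y t ^ 3 - s * y t - \<omega>))\<^sup>2 = 1 + (norm s)\<^sup>2 + (norm \<omega>)\<^sup>2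
          - 2 * Re (cnj s * y t ^ 2) - 2 * Re (cnj \<omega> * y t ^ 3) + 2 * Re (cnj \<omega> * (s * y t))"
        unfolding norm_diff_diff_power2 y(1,2) y(3)[symmetric] by (simp add: mult_ac)
      then show ?thesis
        by (simp only:) (simp add: algebra_simps)
    qed
    have "((\<lambda>t. h t * (norm (y t ^ 3 - s * y t - \<omega>))\<^sup>2) has_integral
        2 * pi * (1 + (norm s)\<^sup>2 + (norm \<omega>)\<^sup>2)
        - Re (2 * cnj s * (pi * C 2)) - Re (2 * cnj \<omega> * (pi * C 3))
        + Re (2 * cnj \<omega> * s * (pi * C 1))) {0..2*pi}" (is "(_ has_integral ?I) _")
      unfolding expand
      by (intro has_integral_add has_integral_diff has_integral_mult_left mass moment) auto
    moreover have "0 \<le> h t * (norm (y t ^ 3 - s * y t - \<omega>))\<^sup>2" for t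
      using r by (simp add: h_def pos norm_mult)
    ultimately have "0 \<le> ?I"
      by (rule has_integral_nonneg)
    also have "?I = 2 * pi * (1 + (norm \<omega>)\<^sup>2 - \<mu> * (1 - \<mu>) * (norm (C 2))\<^sup>2
        - Re (cnj \<omega> * (C 3 - of_real \<mu> * C 1 * C 2)))"
      unfolding s_def norm_mult cmod_power2 power_mult_distrib
      by (simp add: algebra_simps power2_eq_square)
    also have "C 3 - of_real \<mu> * C 1 * C 2 = w * of_real (r ^ 3)"
      by (simp add: C_def w_def algebra_simps power3_eq_cube power2_eq_square)
    also have "Re (cnj \<omega> * (w * of_real (r ^ 3))) = norm w * r ^ 3"
    proof -
      have "cnj \<omega> * w = of_real (norm w)"
        using complex_norm_square[of w, symmetric]
        by (simp add: \<omega>_def sgn_eq power2_eq_square mult.commute)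
      then show ?thesis by (simp flip: mult.assoc of_real_power of_real_mult)
    qed
    finally have "norm w * r ^ 3 \<le> 1 + (norm \<omega>)\<^sup>2 - \<mu> * (1 - \<mu>) * (norm (C 2))\<^sup>2"
      using pi_gt_zero by (simp add: zero_le_mult_iff)
    also have "\<dots> \<le> 1 + 1 - 0"
      using mu by (intro diff_mono add_mono mult_nonneg_nonneg) (auto simp: \<omega>_def norm_sgn)
    finally show ?thesis by simp
  qed
  \<comment> \<open>\<open>Re p\<close> need not have boundary values on the unit circle, hence the passage to the limit.\<close>
  have "((\<lambda>r. norm w * r ^ 3) \<longlongrightarrow> norm w * 1 ^ 3) (at_left 1)"
    by (intro tendsto_intros)
  moreover have "\<forall>\<^sub>F r in at_left (1::real). norm w * r ^ 3 \<le> 2"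
    using eventually_at_left_real[of 0 "1::real"] by (auto elim!: eventually_mono simp: bound)
  ultimately have "norm w * 1 ^ 3 \<le> 2"
    by (rule tendsto_upperbound) simp
  then show ?thesis by (simp add: w_def)
qed

section \<open>From the class to functions with positive real part\<close>

definition weighted_quot_deriv :: "real \<Rightarrow> (complex \<Rightarrow> complex) \<Rightarrow> complex \<Rightarrow> complex" where
  "weighted_quot_deriv \<beta> f z = of_real \<beta> * quot_z f z + of_real (1 - \<beta>) * deriv f z"

lemma class_A_normalized:
  assumes "f \<in> class_A"
  shows "f holomorphic_on unit_disc" "coef f 0 = 0" "coef f 1 = 1"
proof -
  show hol: "f holomorphic_on unit_disc" using assms by (simp add: class_A_def)
  have sums: "(\<lambda>n. coef f (n + 2) * z ^ (n + 2)) sums (f z - z)" if "z \<in> unit_disc" for z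
    using assms that by (simp add: class_A_def)
  have "f 0 = 0"
    using sums[of 0] by (simp add: sums_iff)
  then show c0: "coef f 0 = 0" by (simp add: coef_def fps_expansion_def)
  \<comment> \<open>Compare, at one nonzero point, the Taylor series of \<open>f\<close> with the series in the definition of
    \<open>class_A\<close>: they share all terms from degree 2 on.\<close>
  define z :: complex where "z = 1/2"
  have z: "z \<in> unit_disc" "z \<noteq> 0" by (auto simp: z_def)
  have "(\<lambda>n. coef f (n + 2) * z ^ (n + 2)) sums (f z - (\<Sum>n<2. coef f n * z ^ n))"
    using sums_split_initial_segment[OF sums_coef[OF hol z(1)], of 2] .
  from sums_unique2[OF this sums[OF z(1)]] show "coef f 1 = 1"
    using z(2) c0 by (simp add: eval_nat_numeral)
qed

lemma weighted_quot_deriv_holomorphic: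
  assumes "f \<in> class_A"
  shows "weighted_quot_deriv \<beta> f holomorphic_on unit_disc"
proof -
  note f = class_A_normalized[OF assms]
  have "f 0 = 0" "deriv f 0 = 1"
    using f(2,3) by (auto simp: coef_def fps_expansion_def)
  then have "quot_z f = (\<lambda>z. if z = 0 then deriv f 0 else (f z - f 0) / (z - 0))"
    by (auto simp: quot_z_def)
  then have "quot_z f holomorphic_on unit_disc"
    using pole_lemma[OF f(1), of 0] by simp
  then show ?thesis
    unfolding weighted_quot_deriv_def using f(1) by (intro holomorphic_intros) auto
qed

lemma coef_weighted_quot_deriv:
  assumes "f \<in> class_A"
  shows "coef (weighted_quot_deriv \<beta> f) n = of_real (\<beta> + (1 - \<beta>) * real (Suc n)) * coef f (Suc n)"
proof -
  note f = class_A_normalized[OF assms]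
  define F where "F = fps_expansion f 0"
  have F: "f has_fps_expansion F"
    unfolding F_def by (rule has_fps_expansion_on_disc[OF f(1)])
  have "F \<noteq> 0" using f(3) by (auto simp: coef_def F_def)
  then have "1 \<le> subdegree F"
    using f(2) by (intro subdegree_geI) (auto simp: coef_def F_def)
  then have "(\<lambda>z. if z = 0 then 1 else f z / z ^ 1) has_fps_expansion fps_shift 1 F"
    using F f(3) by (intro has_fps_expansion_shift) (auto simp: coef_def F_def)
  then have "quot_z f has_fps_expansion fps_shift 1 F"
    unfolding quot_z_def[abs_def] power_one_right .
  then have "weighted_quot_deriv \<beta> f has_fps_expansion
      fps_const (of_real \<beta>) * fps_shift 1 F + fps_const (of_real (1 - \<beta>)) * fps_deriv F"
    unfolding weighted_quot_deriv_def using F by (intro fps_expansion_intros)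
  from coef_eqI[OF this, of n] show ?thesis
    by (simp add: coef_def F_def algebra_simps)
qed

section \<open>The extremal function\<close>

lemma in_class_A_of_coeffs:
  assumes bounded: "\<And>n. norm (a n) \<le> B" and a: "a 0 = 0" "a 1 = 1"
  defines "f \<equiv> eval_fps (Abs_fps a)"
  shows "f \<in> class_A" "coef f n = a n"
proof -
  have "1 \<le> fps_conv_radius (Abs_fps a)"
    unfolding fps_conv_radius_def
  proof (rule conv_radius_geI_ex')
    fix r :: real assume r: "0 < r" "ereal r < 1"
    have "summable (\<lambda>n. B * r ^ n)"
      using r by (intro summable_mult summable_geometric) auto
    then show "summable (\<lambda>n. fps_nth (Abs_fps a) n * of_real r ^ n)"
      by (rule summable_comparison_test')
         (use r bounded in \<open>auto simp: norm_mult norm_power intro!: mult_right_mono\<close>)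
  qed
  then have rad: "1 \<le> fps_conv_radius (Abs_fps a)" "0 < fps_conv_radius (Abs_fps a)"
    by (auto intro: less_le_trans[of 0 1])
  have "ereal (norm z) < fps_conv_radius (Abs_fps a)" if "norm z < 1" for z :: complex
    using that less_le_trans[OF _ rad(1), of "ereal (norm z)"] by simp
  then have hol: "f holomorphic_on unit_disc"
    unfolding f_def by (intro holomorphic_intros) auto
  show coef: "coef f n = a n" for n
    using coef_eqI[OF eval_fps_has_fps_expansion[OF rad(2)], of n] by (simp add: f_def)
  have "(\<lambda>n. coef f (n + 2) * z ^ (n + 2)) sums (f z - z)" if "z \<in> unit_disc" for z
    using sums_split_initial_segment[OF sums_coef[OF hol that], of 2] coef a
    by (simp add: eval_nat_numeral)
  with hol show "f \<in> class_A" by (simp add: class_A_def)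
qed

text \<open>The sum is \<open>2 / (1 - z ^ m) - 1\<close>, a geometric series in \<open>z ^ m\<close>.\<close>

lemma half_plane_power_series:
  assumes "z \<in> unit_disc" "0 < m"
  shows "(\<lambda>n. (if n = 0 then 1 else if m dvd n then 2 else 0) * z ^ n) sums ((1 + z ^ m) / (1 - z ^ m))"
proof -
  have lt: "norm (z ^ m) < 1" using assms by (simp add: norm_power power_less_one_iff)
  then have ne: "1 - z ^ m \<noteq> 0" by auto
  have "(\<lambda>k. (if m dvd m * k then z ^ (m * k) else 0)) sums (1 / (1 - z ^ m))"
    using geometric_sums[OF lt] by (simp add: power_mult)
  then have "(\<lambda>n. if m dvd n then z ^ n else 0) sums (1 / (1 - z ^ m))"
    using assms(2)
    by (subst (asm) sums_mono_reindex[where f = "\<lambda>n. if m dvd n then z ^ n else 0"])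
      (auto simp: strict_mono_def)
  from sums_diff[OF sums_mult[OF this, of 2] sums_single[of 0 "\<lambda>_. 1"]]
  have "(\<lambda>n. 2 * (if m dvd n then z ^ n else 0) - (if n = 0 then 1 else 0)) sums (2 * (1 / (1 - z ^ m)) - 1)" .
  also have "(\<lambda>n. 2 * (if m dvd n then z ^ n else 0) - (if n = 0 then 1 else 0)) =
     (\<lambda>n. (if n = 0 then 1 else if m dvd n then 2 else 0) * z ^ n)"
    by auto
  also have "2 * (1 / (1 - z ^ m)) - 1 = (1 + z ^ m) / (1 - z ^ m)"
    using ne by (simp add: field_simps)
  finally show ?thesis .
qed

lemma Re_half_plane_pos:
  assumes "norm w < 1"
  shows "0 < Re ((1 + w) / (1 - w))"
proof -
  have ne: "1 - w \<noteq> 0" using assms by auto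
  have "(norm w)\<^sup>2 < 1" using assms by (simp add: power_less_one_iff)
  then have "0 < (1 + Re w) * (1 - Re w) - Im w * Im w"
    unfolding cmod_power2 by (simp add: algebra_simps power2_eq_square)
  then show ?thesis
    using ne by (simp add: Re_divide' complex_is_Real_iff)
qed

text \<open>Dividing the coefficients \<open>1, 0, 0, 2, 0, 0, 2, ...\<close> of \<open>(1 + z\<^sup>3) / (1 - z\<^sup>3)\<close> by the factors
  \<open>\<beta> + (1 - \<beta>) * n\<close> of \<open>coef_weighted_quot_deriv\<close> leaves these coefficients for \<open>f\<close>.\<close>

definition extremal_coeff :: "real \<Rightarrow> nat \<Rightarrow> complex" where
  "extremal_coeff \<beta> n =
     (if n = 1 then 1 else if n mod 3 = 1 then of_real (2 / (\<beta> + (1 - \<beta>) * n)) else 0)"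

section \<open>The sharp bound\<close>

theorem theorem2p5:
  fixes \<beta> :: real
  assumes "\<beta> \<in> {0..1}"
  shows "(\<forall>f\<in>class_A_beta \<beta>. norm (zalcman 2 3 f) \<le> 2 / (4 - 3 * \<beta>)) \<and>
         (\<exists>f\<in>class_A_beta \<beta>. norm (zalcman 2 3 f) = 2 / (4 - 3 * \<beta>))"
proof (intro conjI ballI)
  have beta: "0 \<le> \<beta>" "\<beta> \<le> 1" using assms by auto
  fix f assume "f \<in> class_A_beta \<beta>"
  then have A: "f \<in> class_A" and pos: "\<And>z. z \<in> unit_disc \<Longrightarrow> 0 < Re (weighted_quot_deriv \<beta> f z)"
    by (auto simp: class_A_beta_def weighted_quot_deriv_def)
  define p where "p = weighted_quot_deriv \<beta> f"
  define d2 d3 d4 where d: "d2 = 2 - \<beta>" "d3 = 3 - 2 * \<beta>" "d4 = 4 - 3 * \<beta>"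
  have dpos: "0 < d2" "0 < d3" "0 < d4" using beta by (auto simp: d)
  define \<mu> where "\<mu> = d4 / (d2 * d3)"
  have "d2 * d3 - d4 = 2 * (1 - \<beta>)\<^sup>2"
    by (simp add: d algebra_simps power2_eq_square)
  then have "d4 \<le> d2 * d3"
    using zero_le_power2[of "1 - \<beta>"] by linarith
  then have mu: "0 \<le> \<mu>" "\<mu> \<le> 1"
    using dpos by (auto simp: \<mu>_def)
  have c: "coef p 1 = of_real d2 * coef f 2" "coef p 2 = of_real d3 * coef f 3"
      "coef p 3 = of_real d4 * coef f 4"
    using coef_weighted_quot_deriv[OF A, of \<beta> 1] coef_weighted_quot_deriv[OF A, of \<beta> 2]
      coef_weighted_quot_deriv[OF A, of \<beta> 3]
    by (simp_all add: p_def d algebra_simps eval_nat_numeral)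
  have eq: "coef p 3 - of_real \<mu> * coef p 1 * coef p 2 = - (of_real d4 * zalcman 2 3 f)"
    using dpos by (simp add: c[simplified] zalcman_def \<mu>_def field_simps)
  have "p 0 = 1"
    using class_A_normalized(3)[OF A]
    by (simp add: p_def weighted_quot_deriv_def quot_z_def coef_def fps_expansion_def)
  then have "norm (coef p 3 - of_real \<mu> * coef p 1 * coef p 2) \<le> 2"
    using weighted_quot_deriv_holomorphic[OF A] less_imp_le[OF pos] mu
    unfolding p_def by (intro caratheodory_class_bound)
  then show "norm (zalcman 2 3 f) \<le> 2 / (4 - 3 * \<beta>)"
    using dpos unfolding eq norm_minus_cancel norm_mult norm_of_real
    by (simp add: d field_simps)
next
  have beta: "0 \<le> \<beta>" "\<beta> \<le> 1" using assms by auto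
  define f where "f = eval_fps (Abs_fps (extremal_coeff \<beta>))"
  have weight: "1 \<le> \<beta> + (1 - \<beta>) * real n" if "0 < n" for n
    using mult_left_mono[of 1 "real n" "1 - \<beta>"] beta that by simp
  have bounded: "norm (extremal_coeff \<beta> n) \<le> 2" for n
  proof (cases "n = 0")
    case False
    then show ?thesis
      using weight[of n] by (simp add: extremal_coeff_def divide_le_eq del: of_real_divide)
  qed (simp add: extremal_coeff_def)
  have A: "f \<in> class_A" and coef_f: "coef f n = extremal_coeff \<beta> n" for n
    unfolding f_def by (rule in_class_A_of_coeffs[OF bounded]; simp add: extremal_coeff_def)+
  have coef_p: "coef (weighted_quot_deriv \<beta> f) n = (if n = 0 then 1 else if 3 dvd n then 2 else 0)" for n
  proof -
    have "\<beta> + (1 - \<beta>) * real (Suc n) \<noteq> 0"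
      using weight[of "Suc n"] by linarith
    then have "complex_of_real (\<beta> + (1 - \<beta>) * real (Suc n)) \<noteq> 0"
      by (simp only: of_real_eq_0_iff not_False_eq_True)
    moreover have "Suc n mod 3 = 1 \<longleftrightarrow> 3 dvd n" by presburger
    ultimately show ?thesis
      unfolding coef_weighted_quot_deriv[OF A] coef_f extremal_coeff_def
      by (cases "n = 0") (simp, simp del: of_nat_Suc of_real_add)
  qed
  have "0 < Re (weighted_quot_deriv \<beta> f z)" if z: "z \<in> unit_disc" for z
  proof -
    have "(\<lambda>n. (if n = 0 then 1 else if 3 dvd n then 2 else 0) * z ^ n) sums weighted_quot_deriv \<beta> f z"
      using sums_coef[OF weighted_quot_deriv_holomorphic[OF A, of \<beta>] z] unfolding coef_p .
    with half_plane_power_series[OF z, of 3] have "weighted_quot_deriv \<beta> f z = (1 + z ^ 3) / (1 - z ^ 3)"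
      by (auto intro: sums_unique2)
    then show ?thesis
      using z Re_half_plane_pos[of "z ^ 3"] by (simp add: norm_power power_less_one_iff)
  qed
  with A have "f \<in> class_A_beta \<beta>"
    by (simp add: class_A_beta_def weighted_quot_deriv_def)
  moreover have "zalcman 2 3 f = - of_real (2 / (4 - 3 * \<beta>))"
    by (simp add: zalcman_def coef_f extremal_coeff_def algebra_simps)
  then have "norm (zalcman 2 3 f) = 2 / (4 - 3 * \<beta>)"
    using beta by (simp add: norm_divide del: of_real_divide)
  ultimately show "\<exists>f\<in>class_A_beta \<beta>. norm (zalcman 2 3 f) = 2 / (4 - 3 * \<beta>)"
    by blast
qed

end
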